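(* Let $E$ be a real normed space ordered by a proper closed cone $C$, and assume at least one of: (1) $C$ has nonempty interior; (2) $E$ is complete; (3) $C$ is a distance set (for every $x\in E$ there is $y\in C$ with $\|x-y\|=\operatorname{dist}(x,C)$). Let $0<T\leq\infty$, $I=[0,T)$, $U\subset E$ open and convex, and $f\colon I\times U\to E$ a continuous locally Lipschitz map such that $f(t,\cdot)$ is quasi-monotone increasing and convex on $U$ for all $t\in I$. Let $0<t_0\leq T$ and let $x_1,x_2,x_3\colon[0,t_0)\to U$ be differentiable maps with $\dot x_i(t)=f(t,x_i(t))$ for $i=1,2,3$ and $x_3(0)=\lambda x_1(0)+(1-\lambda)x_2(0)$ for some $\lambda\in[0,1]$. Then $x_3(t)\leq\lambda x_1(t)+(1-\lambda)x_2(t)$ for all $t\in[0,t_0)$.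
   Context: A cone $C$ ($\lambda C\subset C$ for $\lambda>0$) is proper if $C+C\subset C$ and $C\cap(-C)=\{0\}$; it induces the partial order $x\leq y$ iff $y-x\in C$. $C^*=\{l\in E^*: l(x)\geq0\ \forall x\in C\}$, where $E^*$ is the (continuous) dual. A map $g\colon D\to E$ is quasi-monotone increasing if for all $x,y\in D$, $l\in C^*$: $x\leq y$, $l(x)=l(y)$ imply $l(g(x))\leq l(g(y))$. A map $g$ is convex if its domain is convex and $g(\lambda x+(1-\lambda)y)\leq\lambda g(x)+(1-\lambda)g(y)$ for $\lambda\in[0,1]$. $f$ is locally Lipschitz if for every compact $K\subset U$ and every $t\in I$, $\sup_{0\leq\tau\leq t,\,x_1\neq x_2\in K}\|f(\tau,x_2)-f(\tau,x_1)\|/\|x_2-x_1\|<\infty$. *)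

theory Defs
  imports "HOL-Analysis.Analysis"
begin

definition is_cone :: "'a::real_vector set \<Rightarrow> bool" where
  "is_cone C \<longleftrightarrow> (\<forall>c::real. \<forall>x\<in>C. c > 0 \<longrightarrow> c *\<^sub>R x \<in> C)"

definition proper_cone :: "'a::real_vector set \<Rightarrow> bool" where
  "proper_cone C \<longleftrightarrow> is_cone C \<and> (\<forall>x\<in>C. \<forall>y\<in>C. x + y \<in> C)
      \<and> C \<inter> uminus ` C = {0}"

definition cone_le :: "'a::real_vector set \<Rightarrow> 'a \<Rightarrow> 'a \<Rightarrow> bool" where
  "cone_le C x y \<longleftrightarrow> y - x \<in> C"

definition dual_cone :: "'a::real_normed_vector set \<Rightarrow> ('a \<Rightarrow> real) set" where
  "dual_cone C = {l. bounded_linear l \<and> (\<forall>x\<in>C. l x \<ge> 0)}"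

definition quasi_monotone_increasing ::
  "'a::real_normed_vector set \<Rightarrow> 'a set \<Rightarrow> ('a \<Rightarrow> 'a) \<Rightarrow> bool" where
  "quasi_monotone_increasing C D g \<longleftrightarrow>
     (\<forall>x\<in>D. \<forall>y\<in>D. \<forall>l\<in>dual_cone C.
        cone_le C x y \<and> l x = l y \<longrightarrow> l (g x) \<le> l (g y))"

definition cone_convex_map ::
  "'a::real_vector set \<Rightarrow> 'a set \<Rightarrow> ('a \<Rightarrow> 'a) \<Rightarrow> bool" where
  "cone_convex_map C D g \<longleftrightarrow> convex D \<and>
     (\<forall>x\<in>D. \<forall>y\<in>D. \<forall>c::real. 0 \<le> c \<and> c \<le> 1 \<longrightarrow>
        cone_le C (g (c *\<^sub>R x + (1 - c) *\<^sub>R y)) (c *\<^sub>R g x + (1 - c) *\<^sub>R g y))"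

definition distance_set :: "'a::real_normed_vector set \<Rightarrow> bool" where
  "distance_set C \<longleftrightarrow> (\<forall>x. \<exists>y\<in>C. norm (x - y) = infdist x C)"

definition paper_locally_lipschitz ::
  "real set \<Rightarrow> 'a::real_normed_vector set \<Rightarrow> (real \<Rightarrow> 'a \<Rightarrow> 'a) \<Rightarrow> bool" where
  "paper_locally_lipschitz I U f \<longleftrightarrow>
     (\<forall>K t. compact K \<and> K \<subseteq> U \<and> t \<in> I \<longrightarrow>
        (\<exists>L. \<forall>\<tau>\<in>{0..t}. \<forall>x1\<in>K. \<forall>x2\<in>K. x1 \<noteq> x2 \<longrightarrow>
              norm (f \<tau> x2 - f \<tau> x1) / norm (x2 - x1) \<le> L))"

end

theory Submission
  imports Defs
begin

text \<open>The convex combination \<open>y\<close> of \<open>x1\<close> and \<open>x2\<close> satisfies \<open>y' \<ge> f t y\<close> by convexity of \<open>f t\<close>, so it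
  suffices to compare it with the solution \<open>x3\<close>. Let \<open>p\<close> be a sublinear function vanishing exactly
  on \<open>C\<close>, such as the distance to \<open>C\<close>. By Hahn--Banach, every \<open>z\<close> has a functional \<open>l \<ge> 0\<close> on \<open>C\<close>
  with \<open>- l \<le> p\<close> and \<open>- l z = p z\<close>, and for \<open>z = y t - x3 t\<close> the number \<open>- l (z' t)\<close> bounds the left
  derivative of \<open>p (z t)\<close>. If \<open>l\<close> vanishes at a point \<open>c\<close> of \<open>C\<close> nearest to \<open>z\<close>, then
  quasi-monotonicity for \<open>x3 \<le> x3 + c\<close> and the Lipschitz condition between \<open>x3 + c\<close> and \<open>y\<close>
  bound \<open>- l (z' t)\<close> by a multiple of \<open>p (z t)\<close>, and a Gronwall argument gives \<open>p (z t) = 0\<close>. Such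
  \<open>c\<close> exist for a distance set; if \<open>C\<close> has an interior point \<open>u\<close>, they exist for
  \<open>p z = inf {s \<ge> 0. z + s u \<in> C}\<close> in place of the distance; if the space is complete, they exist
  up to an arbitrarily small perturbation of \<open>l\<close> and \<open>c\<close>, by the Bronsted--Rockafellar theorem.\<close>

section \<open>Sublinear functions and infimal convolution\<close>

definition sublinear :: "('a::real_vector \<Rightarrow> real) \<Rightarrow> bool" where
  "sublinear p \<longleftrightarrow> (\<forall>x y. p (x + y) \<le> p x + p y) \<and> (\<forall>r x. 0 \<le> r \<longrightarrow> p (r *\<^sub>R x) = r * p x)"

text \<open>Applying \<open>scale\<close> with the factor \<open>inverse r\<close> gives the
  converse inequality, so one direction for positive \<open>r\<close> suffices.\<close>

lemma sublinearI:
  assumes add: "\<And>x y. p (x + y) \<le> p x + p y"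
    and scale: "\<And>r x. 0 < r \<Longrightarrow> p (r *\<^sub>R x) \<le> r * p x"
    and zero: "p 0 = 0"
  shows "sublinear p"
  unfolding sublinear_def
proof (intro conjI allI impI)
  fix r :: real and x
  assume "0 \<le> r"
  show "p (r *\<^sub>R x) = r * p x"
  proof (cases "r = 0")
    case False
    with \<open>0 \<le> r\<close> have r: "0 < r" by simp
    have "p (inverse r *\<^sub>R (r *\<^sub>R x)) \<le> inverse r * p (r *\<^sub>R x)"
      using r by (intro scale) simp
    then have "r * p x \<le> p (r *\<^sub>R x)"
      using r by (simp add: field_simps)
    with scale[OF r, of x] show ?thesis by simp
  qed (simp add: zero)
qed (rule add)

lemma sublinear_add: "sublinear p \<Longrightarrow> p (x + y) \<le> p x + p y"
  by (simp add: sublinear_def)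

lemma sublinear_scale: "sublinear p \<Longrightarrow> 0 \<le> r \<Longrightarrow> p (r *\<^sub>R x) = r * p x"
  by (simp add: sublinear_def)

lemma sublinear_zero: "sublinear p \<Longrightarrow> p 0 = 0"
  using sublinear_scale[of p 0 0] by simp

lemma sublinear_minus: "sublinear p \<Longrightarrow> - p (- x) \<le> p x"
  using sublinear_add[of p x "- x"] sublinear_zero[of p] by simp

text \<open>Infimal convolution of a sublinear function with a function that is sublinear on a
  convex cone: the largest sublinear minorant of \<open>q\<close> lying below \<open>l\<close> on the cone.\<close>

definition infconv :: "('a::real_vector \<Rightarrow> real) \<Rightarrow> ('a \<Rightarrow> real) \<Rightarrow> 'a set \<Rightarrow> 'a \<Rightarrow> real" where
  "infconv q l K x = (INF w\<in>K. q (x - w) + l w)"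

text \<open>\<open>l_lower\<close> bounds all values under the infimum below by
  \<open>- q (- x)\<close>, which makes it finite. The case \<open>r = 0\<close> of
  \<open>l_scale\<close> gives \<open>l 0 = 0\<close>, hence
  \<open>infconv q l K \<le> q\<close>.\<close>

locale infconv_cone =
  fixes q l :: "'a::real_vector \<Rightarrow> real" and K :: "'a set"
  assumes q: "sublinear q"
    and K: "convex_cone K"
    and l_add: "\<And>v w. v \<in> K \<Longrightarrow> w \<in> K \<Longrightarrow> l (v + w) \<le> l v + l w"
    and l_scale: "\<And>r w. 0 \<le> r \<Longrightarrow> w \<in> K \<Longrightarrow> l (r *\<^sub>R w) = r * l w"
    and l_lower: "\<And>w. w \<in> K \<Longrightarrow> - q (- w) \<le> l w"
begin

lemmas K_zero = convex_cone_contains_0[OF K]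
  and K_add = convex_cone_add[OF K]
  and K_scale = convex_cone_scaleR[OF K]

lemma lower: "w \<in> K \<Longrightarrow> - q (- x) \<le> q (x - w) + l w"
  using l_lower[of w] sublinear_add[OF q, of "- x" "x - w"] by simp

lemma bdd: "bdd_below ((\<lambda>w. q (x - w) + l w) ` K)"
  using lower by (intro bdd_belowI2)

lemma le: "w \<in> K \<Longrightarrow> infconv q l K x \<le> q (x - w) + l w"
  unfolding infconv_def using bdd by (rule cINF_lower)

lemma greatest: "(\<And>w. w \<in> K \<Longrightarrow> b \<le> q (x - w) + l w) \<Longrightarrow> b \<le> infconv q l K x"
  unfolding infconv_def using K_zero by (intro cINF_greatest) auto

lemma le_q: "infconv q l K x \<le> q x"
  using le[OF K_zero, of x] l_scale[OF _ K_zero, of 0] by simp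

lemma le_l: "w \<in> K \<Longrightarrow> infconv q l K w \<le> l w"
  using le[of w w] sublinear_zero[OF q] by simp

lemma approx:
  assumes "0 < e"
  obtains w where "w \<in> K" "q (x - w) + l w < infconv q l K x + e"
proof -
  have "\<exists>w\<in>K. q (x - w) + l w < infconv q l K x + e"
  proof (rule ccontr)
    assume "\<not> ?thesis"
    then have "infconv q l K x + e \<le> infconv q l K x"
      by (intro greatest) force
    with assms show False by simp
  qed
  with that show thesis by blast
qed

text \<open>Near-minimisers for \<open>x\<close> and \<open>y\<close> add up to a competitor for
  \<open>x + y\<close>, and multiples of competitors for \<open>x\<close> compete for multiples of
  \<open>x\<close>, because \<open>K\<close> is a convex cone.\<close>

lemma sublinear_infconv: "sublinear (infconv q l K)"
proof (rule sublinearI)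
  fix x y
  show "infconv q l K (x + y) \<le> infconv q l K x + infconv q l K y"
  proof (rule field_le_epsilon)
    fix e :: real assume "0 < e"
    then have e: "0 < e / 2" by simp
    obtain v where v: "v \<in> K" "q (x - v) + l v < infconv q l K x + e / 2"
      by (rule approx[OF e])
    obtain w where w: "w \<in> K" "q (y - w) + l w < infconv q l K y + e / 2"
      by (rule approx[OF e])
    have "infconv q l K (x + y) \<le> q (x + y - (v + w)) + l (v + w)"
      by (intro le K_add v w)
    also have "q (x + y - (v + w)) \<le> q (x - v) + q (y - w)"
      using sublinear_add[OF q, of "x - v" "y - w"] by (simp add: algebra_simps)
    finally show "infconv q l K (x + y) \<le> infconv q l K x + infconv q l K y + e"
      using l_add[OF v(1) w(1)] v(2) w(2) by linarith
  qed
next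
  fix r :: real and x assume r: "0 < r"
  have "infconv q l K (r *\<^sub>R x) / r \<le> infconv q l K x"
  proof (rule greatest)
    fix w assume w: "w \<in> K"
    have "infconv q l K (r *\<^sub>R x) \<le> q (r *\<^sub>R x - r *\<^sub>R w) + l (r *\<^sub>R w)"
      using r w by (intro le K_scale) auto
    also have "\<dots> = r * (q (x - w) + l w)"
      using r w by (simp add: sublinear_scale[OF q] l_scale algebra_simps flip: scaleR_diff_right)
    finally show "infconv q l K (r *\<^sub>R x) / r \<le> q (x - w) + l w"
      using r by (simp add: field_simps)
  qed
  with r show "infconv q l K (r *\<^sub>R x) \<le> r * infconv q l K x"
    by (simp add: field_simps)
next
  have "0 \<le> infconv q l K 0"
    using lower[of _ 0] sublinear_zero[OF q] by (intro greatest) auto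
  with le_q[of 0] sublinear_zero[OF q] show "infconv q l K 0 = 0" by simp
qed

end

text \<open>By positive homogeneity \<open>- q (- w)\<close> is additive along the ray of
  \<open>- y\<close>. It is the smallest choice that \<open>l_lower\<close> permits, so a linear
  minorant of the convolution is pushed up to \<open>q\<close> at \<open>y\<close>.\<close>

lemma infconv_ray:
  fixes q :: "'a::real_vector \<Rightarrow> real" and y :: 'a
  assumes q: "sublinear q"
  defines "K \<equiv> {- t *\<^sub>R y |t. 0 \<le> t}"
  shows "infconv_cone q (\<lambda>w. - q (- w)) K"
proof
  show "convex_cone K"
    unfolding convex_cone_iff
  proof (intro conjI ballI allI impI)
    show "0 \<in> K" unfolding K_def by (intro CollectI exI[of _ 0]) simp
  next
    fix v w assume "v \<in> K" "w \<in> K"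
    then obtain s t where "0 \<le> s" "0 \<le> t" "v = - s *\<^sub>R y" "w = - t *\<^sub>R y"
      by (auto simp: K_def)
    then show "v + w \<in> K"
      unfolding K_def by (intro CollectI exI[of _ "s + t"]) (simp add: algebra_simps)
  next
    fix w and r :: real assume "w \<in> K" "0 \<le> r"
    then obtain t where "0 \<le> t" "w = - t *\<^sub>R y" by (auto simp: K_def)
    then show "r *\<^sub>R w \<in> K"
      using \<open>0 \<le> r\<close> unfolding K_def by (intro CollectI exI[of _ "r * t"]) simp
  qed
next
  fix v w assume "v \<in> K" "w \<in> K"
  then obtain s t where st: "0 \<le> s" "0 \<le> t" "v = - s *\<^sub>R y" "w = - t *\<^sub>R y"
    by (auto simp: K_def)
  then have "- (v + w) = (s + t) *\<^sub>R y" by (simp add: algebra_simps)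
  then show "- q (- (v + w)) \<le> - q (- v) + - q (- w)"
    using st by (simp add: sublinear_scale[OF q] ring_distribs)
next
  fix r :: real and w assume "0 \<le> r"
  then show "- q (- (r *\<^sub>R w)) = r * - q (- w)"
    by (simp add: sublinear_scale[OF q] flip: scaleR_minus_right)
qed (use q in auto)

section \<open>The Hahn-Banach theorem by Zorn's lemma\<close>

text \<open>The chain condition supplies one \<open>m\<close> below both \<open>q\<close> and
  \<open>r\<close>, so that \<open>m (x + y) \<le> q x + r y\<close>; an arbitrary infimum of
  sublinear functions need not be subadditive.\<close>

lemma sublinear_INF_chain:
  fixes Q :: "('a::real_vector \<Rightarrow> real) set"
  assumes ne: "Q \<noteq> {}"
    and sub: "\<And>q. q \<in> Q \<Longrightarrow> sublinear q"
    and chain: "\<And>q r. q \<in> Q \<Longrightarrow> r \<in> Q \<Longrightarrow> q \<le> r \<or> r \<le> q"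
    and bdd: "\<And>x. bdd_below ((\<lambda>q. q x) ` Q)"
  shows "sublinear (\<lambda>x. INF q\<in>Q. q x)"
proof (rule sublinearI)
  fix x y
  have "(INF q\<in>Q. q (x + y)) - r y \<le> q x" if "q \<in> Q" "r \<in> Q" for q r
  proof -
    obtain m where m: "m \<in> Q" "m \<le> q" "m \<le> r"
      using chain[of q r] \<open>q \<in> Q\<close> \<open>r \<in> Q\<close> by auto
    have "(INF q\<in>Q. q (x + y)) \<le> m (x + y)"
      by (rule cINF_lower[OF bdd m(1)])
    also have "\<dots> \<le> m x + m y"
      by (rule sublinear_add[OF sub[OF m(1)]])
    also have "\<dots> \<le> q x + r y"
      using m by (intro add_mono) (auto simp: le_fun_def)
    finally show ?thesis by simp
  qed
  then have "(INF q\<in>Q. q (x + y)) - r y \<le> (INF q\<in>Q. q x)" if "r \<in> Q" for r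
    using ne that by (intro cINF_greatest) auto
  then have "(INF q\<in>Q. q (x + y)) - (INF q\<in>Q. q x) \<le> (INF q\<in>Q. q y)"
    using ne by (intro cINF_greatest) (auto simp: algebra_simps)
  then show "(INF q\<in>Q. q (x + y)) \<le> (INF q\<in>Q. q x) + (INF q\<in>Q. q y)" by simp
next
  fix r :: real and x assume r: "0 < r"
  have "(INF q\<in>Q. q (r *\<^sub>R x)) / r \<le> (INF q\<in>Q. q x)"
  proof (intro cINF_greatest ne)
    fix q assume q: "q \<in> Q"
    have "(INF q\<in>Q. q (r *\<^sub>R x)) \<le> q (r *\<^sub>R x)"
      by (rule cINF_lower[OF bdd q])
    also have "\<dots> = r * q x"
      using r sublinear_scale[OF sub[OF q]] by simp
    finally show "(INF q\<in>Q. q (r *\<^sub>R x)) / r \<le> q x"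
      using r by (simp add: field_simps)
  qed
  with r show "(INF q\<in>Q. q (r *\<^sub>R x)) \<le> r * (INF q\<in>Q. q x)"
    by (simp add: field_simps)
next
  have "(INF q\<in>Q. q 0) = (INF q\<in>Q. 0 :: real)"
    by (intro INF_cong refl sublinear_zero sub)
  also have "\<dots> = 0" by (rule cINF_const[OF ne])
  finally show "(INF q\<in>Q. q 0) = 0" .
qed

text \<open>By Zorn's lemma there is a minimal sublinear \<open>m \<le> p\<close>. It is linear, because
  it equals its infimal convolution with \<open>w \<mapsto> - m (- w)\<close> along any ray.\<close>

lemma exists_linear_minorant:
  assumes p: "sublinear p"
  obtains l where "linear l" "\<And>x. l x \<le> p x"
proof -
  define A where "A = {q. sublinear q \<and> q \<le> p}"
  have pA: "p \<in> A" using p by (simp add: A_def)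
  have "\<exists>m\<in>A. \<forall>a\<in>A. a \<le> m \<longrightarrow> a = m"
  proof (rule predicate_Zorn)
    \<comment> \<open>The order is reversed, so that a maximal element is a minimal sublinear
      function.\<close>
    show "partial_order_on A (relation_of (\<lambda>a b. b \<le> a) A)"
      by (rule partial_order_on_relation_ofI) auto
  next
    fix Q assume Q: "Q \<in> Chains (relation_of (\<lambda>a b. b \<le> a) A)"
    then have QA: "q \<in> A" if "q \<in> Q" for q
      using that unfolding Chains_def relation_of_def by auto
    show "\<exists>u\<in>A. \<forall>a\<in>Q. u \<le> a"
    proof (cases "Q = {}")
      case True
      with pA show ?thesis by blast
    next
      case False
      \<comment> \<open>This bound is uniform in \<open>q\<close>, so the pointwise infimum over the
        chain is finite.\<close>
      have "- p (- x) \<le> q x" if "q \<in> Q" for q x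
        using QA[OF that] sublinear_minus[of q x]
        by (force simp: A_def le_fun_def dest: spec[of _ "- x"])
      then have bdd: "bdd_below ((\<lambda>q. q x) ` Q)" for x
        by (intro bdd_belowI2)
      have "sublinear (\<lambda>x. INF q\<in>Q. q x)"
        using Q QA by (intro sublinear_INF_chain False bdd)
          (auto simp: A_def Chains_def relation_of_def)
      moreover have lower: "(\<lambda>x. INF q\<in>Q. q x) \<le> a" if "a \<in> Q" for a
        using cINF_lower[OF bdd that] by (simp add: le_fun_def)
      moreover obtain a where "a \<in> Q" using False by blast
      ultimately have "(\<lambda>x. INF q\<in>Q. q x) \<in> A"
        using QA[OF \<open>a \<in> Q\<close>] order_trans[OF lower] by (auto simp: A_def)
      with lower show ?thesis by blast
    qed
  qed
  then obtain m where m: "sublinear m" "m \<le> p" and min: "\<And>a. a \<in> A \<Longrightarrow> a \<le> m \<Longrightarrow> a = m"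
    by (auto simp: A_def)
  have add: "m (x + y) = m x + m y" for x y
  proof -
    define K where "K = {- t *\<^sub>R y |t. 0 \<le> t}"
    interpret infconv_cone m "\<lambda>w. - m (- w)" K
      unfolding K_def by (rule infconv_ray[OF m(1)])
    have "infconv m (\<lambda>w. - m (- w)) K \<le> m"
      using le_q by (simp add: le_fun_def)
    then have "infconv m (\<lambda>w. - m (- w)) K = m"
      using sublinear_infconv m(2) by (intro min) (auto simp: A_def)
    \<comment> \<open>The competitor \<open>- y\<close> yields the converse of
      subadditivity.\<close>
    moreover have "- y \<in> K"
      unfolding K_def by (intro CollectI exI[of _ 1]) simp
    ultimately have "m x \<le> m (x + y) - m y"
      using le[of "- y" x] by simp
    with sublinear_add[OF m(1), of x y] show ?thesis by simp
  qed
  have neg: "m (- x) = - m x" for x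
    using add[of x "- x"] sublinear_zero[OF m(1)] by simp
    have "m (r *\<^sub>R x) = r *\<^sub>R m x" for r x
    using neg[of "r *\<^sub>R x"] sublinear_scale[OF m(1), of r x] sublinear_scale[OF m(1), of "- r" x]
    by (cases "0 \<le> r") auto
  then have "linear m" by (intro linearI add)
  with m(2) show thesis by (intro that) (auto simp: le_fun_def)
qed

text \<open>A linear \<open>l\<close> below the convolution along the ray of \<open>- v\<close>
  satisfies \<open>l (- v) \<le> - p v\<close>, that is, \<open>p v \<le> l v\<close>.\<close>

lemma exists_linear_minorant_touching:
  assumes p: "sublinear p"
  obtains l where "linear l" "\<And>x. l x \<le> p x" "l v = p v"
proof -
  define K where "K = {- t *\<^sub>R v |t. 0 \<le> t}"
  interpret infconv_cone p "\<lambda>w. - p (- w)" K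
    unfolding K_def by (rule infconv_ray[OF p])
  obtain l where l: "linear l" "\<And>x. l x \<le> infconv p (\<lambda>w. - p (- w)) K x"
    using exists_linear_minorant[OF sublinear_infconv] by blast
  have "- v \<in> K"
    unfolding K_def by (intro CollectI exI[of _ 1]) simp
  then have "l (- v) \<le> - p v"
    using le_l[of "- v"] l(2)[of "- v"] by simp
  then have "p v \<le> l v" using linear_neg[OF l(1)] by simp
  moreover have "l x \<le> p x" for x using l(2)[of x] le_q[of x] by simp
  ultimately show thesis using l(1) by (intro that[of l]) (auto intro: antisym)
qed

section \<open>Ekeland's principle and support functionals of cones\<close>

text \<open>\<open>R x\<close> is the set of points below \<open>x\<close> in Ekeland's order. A
  sequence descends through these sets, each term nearly minimising \<open>g\<close> on the set of
  the previous one. The drop of \<open>g\<close> bounds the distances, so the sequence converges,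
  and \<open>c\<close> is its limit.\<close>

lemma Ekeland_variational_principle:
  fixes g :: "'a::metric_space \<Rightarrow> real"
  assumes S: "complete S" and cont: "continuous_on S g"
    and bdd: "\<And>x. x \<in> S \<Longrightarrow> b \<le> g x" and a: "a \<in> S" and e: "0 < e"
  obtains c where "c \<in> S" "g c + e * dist a c \<le> g a"
    "\<And>u. u \<in> S \<Longrightarrow> g c \<le> g u + e * dist c u"
proof -
  define R where "R x = {u \<in> S. g u + e * dist x u \<le> g x}" for x
  have R_trans: "w \<in> R x" if "v \<in> R x" "w \<in> R v" for x v w
  proof -
    have "e * dist x w \<le> e * (dist x v + dist v w)"
      using e by (intro mult_left_mono dist_triangle) auto
    with that show ?thesis by (auto simp: R_def distrib_left)
  qed
  have step: "\<exists>u. u \<in> R x \<and> (\<forall>v\<in>R x. g u \<le> g v + (1/2) ^ n)" if "x \<in> S" for x and n :: nat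
  proof -
    have ne: "R x \<noteq> {}" using that by (force simp: R_def)
    have bdd': "bdd_below (g ` R x)"
      using bdd by (intro bdd_belowI2[of _ b]) (simp add: R_def)
    have "(INF u\<in>R x. g u) < (INF u\<in>R x. g u) + (1/2) ^ n" by simp
    then obtain u where u: "u \<in> R x" "g u < (INF u\<in>R x. g u) + (1/2) ^ n"
      using cINF_less_iff[OF ne bdd'] by blast
    have "g u \<le> g v + (1/2) ^ n" if "v \<in> R x" for v
      using cINF_lower[OF bdd' that] u(2) by linarith
    with u(1) show ?thesis by blast
  qed
  have "\<exists>u. \<forall>n. u n \<in> S \<inter> R a \<and>
      (u (Suc n) \<in> R (u n) \<and> (\<forall>v\<in>R (u n). g (u (Suc n)) \<le> g v + (1/2) ^ n))"
  proof (rule dependent_nat_choice)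
    show "\<exists>x. x \<in> S \<inter> R a" using a by (force simp: R_def)
  next
    fix x and n :: nat assume x: "x \<in> S \<inter> R a"
    then obtain u where "u \<in> R x" "\<forall>v\<in>R x. g u \<le> g v + (1/2) ^ n"
      using step[of x n] by blast
    with x R_trans[of x a u]
    show "\<exists>u. u \<in> S \<inter> R a \<and> u \<in> R x \<and> (\<forall>v\<in>R x. g u \<le> g v + (1/2) ^ n)"
      by (auto simp: R_def)
  qed
  then obtain u where uS: "\<And>n. u n \<in> S" and ua: "\<And>n. u n \<in> R a"
    and uR: "\<And>n. u (Suc n) \<in> R (u n)"
    and umin: "\<And>n v. v \<in> R (u n) \<Longrightarrow> g (u (Suc n)) \<le> g v + (1/2) ^ n"
    by blast
  have uR': "u n \<in> R (u m)" if "m \<le> n" for m n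
    using that
  proof (induction n rule: dec_induct)
    case base
    show ?case using uS by (simp add: R_def)
  next
    case (step n)
    show ?case by (rule R_trans[OF step.IH uR])
  qed
  have "decseq (\<lambda>n. g (u n))"
  proof (rule decseq_SucI)
    fix n
    have "0 \<le> e * dist (u n) (u (Suc n))" using e by simp
    with uR[of n] show "g (u (Suc n)) \<le> g (u n)" by (simp add: R_def)
  qed
  then obtain L where L: "(\<lambda>n. g (u n)) \<longlonglongrightarrow> L" "\<And>n. L \<le> g (u n)"
    using decseq_convergent[of "\<lambda>n. g (u n)" b] bdd[OF uS] by metis
  have dist_u: "dist (u m) (u n) \<le> (g (u m) - L) / e" if "m \<le> n" for m n
    using uR'[OF that] L(2)[of n] e by (simp add: R_def field_simps)
  have "Cauchy u"
    unfolding Cauchy_altdef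
  proof (intro allI impI)
    fix d :: real assume "0 < d"
    then have "\<forall>\<^sub>F n in sequentially. g (u n) < L + d * e"
      using e by (intro order_tendstoD(2)[OF L(1)]) simp
    then obtain N where N: "g (u n) < L + d * e" if "N \<le> n" for n
      by (auto simp: eventually_sequentially)
    have "dist (u m) (u n) < d" if "N \<le> m" "m < n" for m n
    proof -
      have "(g (u m) - L) / e < d"
        using N[OF that(1)] e by (simp add: field_simps)
      with dist_u[of m n] that(2) show ?thesis by simp
    qed
    then show "\<exists>M. \<forall>m\<ge>M. \<forall>n>m. dist (u m) (u n) < d" by blast
  qed
  then obtain c where c: "c \<in> S" "u \<longlonglongrightarrow> c"
    using S uS by (auto simp: complete_def)
  have gc: "(\<lambda>n. g (u n)) \<longlonglongrightarrow> g c"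
    by (rule continuous_on_tendsto_compose[OF cont c(2) c(1)]) (simp add: uS)
  have cR: "c \<in> R x" if "\<forall>\<^sub>F n in sequentially. u n \<in> R x" for x
  proof -
    have "(\<lambda>n. g (u n) + e * dist x (u n)) \<longlonglongrightarrow> g c + e * dist x c"
      by (intro tendsto_intros gc c)
    then have "g c + e * dist x c \<le> g x"
      by (rule tendsto_upperbound) (use that in \<open>auto elim!: eventually_mono simp: R_def\<close>)
    with c show ?thesis by (simp add: R_def)
  qed
  have ca: "c \<in> R a" by (rule cR) (simp add: ua)
  have cu: "c \<in> R (u n)" for n
    by (rule cR) (use uR' in \<open>auto simp: eventually_sequentially\<close>)
  \<comment> \<open>A point \<open>w\<close> violating the claim lies in \<open>R c\<close>, hence
    in every \<open>R (u n)\<close>; near-minimality of \<open>u (Suc n)\<close> then gives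
    \<open>g c \<le> g w\<close> in the limit.\<close>
  have min: "g c \<le> g w + e * dist c w" if "w \<in> S" for w
  proof (rule ccontr)
    assume neg: "\<not> ?thesis"
    then have w: "w \<in> R c" using that by (simp add: R_def)
    have "(\<lambda>n. g w + (1/2) ^ n) \<longlonglongrightarrow> g w + 0"
      by (intro tendsto_intros LIMSEQ_power_zero) simp
    then have "g c \<le> g w"
      by (intro LIMSEQ_le[OF LIMSEQ_Suc[OF gc]]) (use umin R_trans[OF cu w] in auto)
    moreover have "0 \<le> e * dist c w" using e by simp
    ultimately show False using neg by linarith
  qed
  from ca min c(1) show thesis by (intro that) (auto simp: R_def)
qed

text \<open>A Bronsted--Rockafellar theorem for cones. Ekeland's principle moves \<open>c\<close> to a point \<open>c'\<close>
  with \<open>l \<ge> - e * norm\<close> on the cone generated by \<open>C - c'\<close>; a linear function between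
  \<open>- e * norm\<close> and \<open>l\<close> on that cone is the required correction.\<close>

lemma approximate_support_cone:
  fixes C :: "'a::real_normed_vector set"
  assumes C: "convex_cone C" "complete C"
    and l: "l \<in> dual_cone C" and c: "c \<in> C" and e: "0 < e" and small: "l c \<le> e * e"
  obtains c' l' where "c' \<in> C" "l' \<in> dual_cone C" "l' c' = 0" "norm (c - c') \<le> e"
    "\<And>x. \<bar>l' x - l x\<bar> \<le> e * norm x"
proof -
  have bl: "bounded_linear l" and l0: "\<And>x. x \<in> C \<Longrightarrow> 0 \<le> l x"
    using l by (auto simp: dual_cone_def)
  interpret l: bounded_linear l by (rule bl)
  obtain c' where c': "c' \<in> C" "l c' + e * dist c c' \<le> l c"
    and min: "\<And>u. u \<in> C \<Longrightarrow> l c' \<le> l u + e * dist c' u"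
    using Ekeland_variational_principle[OF C(2) linear_continuous_on[OF bl] l0 c e] by metis
  have "e * norm (c - c') \<le> e * e"
    using c' l0[OF c'(1)] small by (simp add: dist_norm)
  then have near: "norm (c - c') \<le> e" using e by simp
  define K where "K = {u - s *\<^sub>R c' |u s. u \<in> C \<and> 0 \<le> s}"
  have KI: "u - s *\<^sub>R c' \<in> K" if "u \<in> C" "0 \<le> s" for u s
    using that by (auto simp: K_def)
  interpret infconv_cone "\<lambda>x. e * norm x" l K
  proof
    show "sublinear (\<lambda>x :: 'a. e * norm x)"
      using e by (intro sublinearI) (auto simp: norm_triangle_ineq simp flip: distrib_left)
    show "convex_cone K"
      unfolding convex_cone_iff
    proof (intro conjI ballI allI impI)
      show "0 \<in> K" using KI[of 0 0] convex_cone_contains_0[OF C(1)] by simp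
    next
      fix v w assume "v \<in> K" "w \<in> K"
      then obtain v' s w' t where vw: "v' \<in> C" "0 \<le> s" "v = v' - s *\<^sub>R c'"
          "w' \<in> C" "0 \<le> t" "w = w' - t *\<^sub>R c'"
        by (auto simp: K_def)
      have "v + w = (v' + w') - (s + t) *\<^sub>R c'" by (simp add: vw(3,6) algebra_simps)
      also have "\<dots> \<in> K"
        using vw convex_cone_add[OF C(1)] by (intro KI) auto
      finally show "v + w \<in> K" .
    next
      fix w and r :: real assume "w \<in> K" "0 \<le> r"
      then obtain w' t where "w' \<in> C" "0 \<le> t" "w = w' - t *\<^sub>R c'" by (auto simp: K_def)
      then show "r *\<^sub>R w \<in> K"
        using KI[of "r *\<^sub>R w'" "r * t"] convex_cone_scaleR[OF C(1)] \<open>0 \<le> r\<close>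
        by (simp add: scaleR_diff_right)
    qed
  next
    fix w assume "w \<in> K"
    then obtain u s where w: "u \<in> C" "0 \<le> s" "w = u - s *\<^sub>R c'" by (auto simp: K_def)
    show "- (e * norm (- w)) \<le> l w"
    proof (cases "s = 0")
      case True
      have "0 \<le> e * norm (- w)" using e by simp
      with True w l0[of u] show ?thesis by simp
    next
      \<comment> \<open>The minimality of \<open>c'\<close> is tested at
        \<open>inverse s *\<^sub>R u\<close> and multiplied by \<open>s\<close>.\<close>
      case False
      with w have s: "0 < s" by simp
      then have "l c' \<le> l (inverse s *\<^sub>R u) + e * norm (c' - inverse s *\<^sub>R u)"
        using min[of "inverse s *\<^sub>R u"] w convex_cone_scaleR[OF C(1)] by (simp add: dist_norm)
      then have "s * l c' \<le> s * (l (inverse s *\<^sub>R u) + e * norm (c' - inverse s *\<^sub>R u))"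
        using s by (intro mult_left_mono) auto
      also have "\<dots> = l u + e * norm (s *\<^sub>R (c' - inverse s *\<^sub>R u))"
        using s unfolding norm_scaleR l.scaleR by (simp add: field_simps)
      also have "s *\<^sub>R (c' - inverse s *\<^sub>R u) = - w"
        using s w by (simp add: scaleR_diff_right)
      finally show ?thesis using w by (simp add: l.diff l.scaleR)
    qed
  qed (auto simp: l.add l.scaleR)
  obtain m where m: "linear m" "\<And>x. m x \<le> infconv (\<lambda>x. e * norm x) l K x"
    using exists_linear_minorant[OF sublinear_infconv] by blast
  have m_le: "m x \<le> e * norm x" for x
    using m(2)[of x] le_q[of x] by simp
  have m_bound: "\<bar>m x\<bar> \<le> e * norm x" for x
    using m_le[of x] m_le[of "- x"] linear_neg[OF m(1), of x] by (simp add: abs_le_iff)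
  have bm: "bounded_linear m"
    using m_bound linear_add[OF m(1)] linear_scale[OF m(1)]
    by (intro bounded_linear_intro[of _ e]) (auto simp: mult.commute)
  \<comment> \<open>Since \<open>m \<le> l\<close> on \<open>K\<close>, the difference is
    nonnegative there. As \<open>K\<close> contains \<open>C\<close> and \<open>- c'\<close>, it
    lies in the dual cone and vanishes at \<open>c'\<close>.\<close>
  define l' where "l' x = l x - m x" for x
  have bl': "bounded_linear l'"
    unfolding l'_def by (rule bounded_linear_sub[OF bl bm])
  have l'K: "0 \<le> l' w" if "w \<in> K" for w
    using m(2)[of w] le_l[OF that] by (simp add: l'_def)
  have l'C: "0 \<le> l' u" if "u \<in> C" for u
    using l'K[of u] KI[OF that, of 0] by simp
  have "0 \<le> l' (- c')"
    using l'K[of "- c'"] KI[OF convex_cone_contains_0[OF C(1)], of 1] by simp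
  then have "l' c' = 0"
    using l'C[OF c'(1)] bounded_linear.linear[OF bl'] by (simp add: linear_neg)
  then show thesis
    using c'(1) bl' l'C near m_bound by (intro that[of c' l']) (auto simp: dual_cone_def l'_def)
qed

section \<open>Gauges of the cone with supporting functionals\<close>

text \<open>A substitute \<open>p\<close> for the distance to the cone \<open>C\<close>, such that every functional realising
  \<open>p z\<close> is approximated by functionals supporting \<open>C\<close> at almost nearest points of \<open>z\<close>.\<close>

locale supported_gauge =
  fixes C :: "'a::real_normed_vector set" and p :: "'a \<Rightarrow> real" and M :: real
  assumes sublinear: "sublinear p"
    and nonneg: "0 \<le> p z"
    and le_norm: "p z \<le> M * norm z"
    and zero_iff: "p z = 0 \<longleftrightarrow> z \<in> C"
    and M_pos: "0 < M"
    and support: "l \<in> dual_cone C \<Longrightarrow> (\<And>x. - l x \<le> p x) \<Longrightarrow> l z = - p z \<Longrightarrow> 0 < e \<Longrightarrow>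
      \<exists>c\<in>C. \<exists>l'\<in>dual_cone C. l' c = 0 \<and> norm (z - c) \<le> M * p z + e \<and>
        (\<forall>x. \<bar>l' x - l x\<bar> \<le> e * norm x)"

text \<open>The distance to \<open>C\<close> is the infimal convolution of the norm with the zero
  function on \<open>C\<close>.\<close>

lemma infdist_cone:
  fixes C :: "'a::real_normed_vector set"
  assumes C: "convex_cone C"
  shows "sublinear (\<lambda>x. infdist x C)" "infdist z C \<le> norm z"
proof -
  have "sublinear (norm :: 'a \<Rightarrow> real)"
    by (intro sublinearI) (auto simp: norm_triangle_ineq)
  then interpret infconv_cone norm "\<lambda>_. 0" C
    by unfold_locales (use C in auto)
  have "infconv norm (\<lambda>_. 0) C = (\<lambda>x. infdist x C)"
    using K_zero by (auto simp: fun_eq_iff infconv_def infdist_def dist_norm)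
  then show "sublinear (\<lambda>x. infdist x C)" "infdist z C \<le> norm z"
    using sublinear_infconv le_q[of z] by simp_all
qed

text \<open>For a nearest point \<open>c\<close>, the estimate
  \<open>- l (z - c) \<le> norm (z - c) = - l z\<close> forces \<open>l c = 0\<close>, so
  \<open>l' = l\<close> serves for every \<open>e\<close>.\<close>

lemma supported_gauge_infdist_distance_set:
  assumes C: "convex_cone C" "closed C" and dist: "distance_set C"
  shows "supported_gauge C (\<lambda>x. infdist x C) 1"
proof
  fix l z and e :: real
  assume l: "l \<in> dual_cone C" "\<And>x. - l x \<le> infdist x C" "l z = - infdist z C" and e: "0 < e"
  obtain c where c: "c \<in> C" "norm (z - c) = infdist z C"
    using dist by (auto simp: distance_set_def)
  interpret l: bounded_linear l using l(1) by (simp add: dual_cone_def)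
  have "- l (z - c) \<ge> - norm (z - c)"
    using l(2)[of "c - z"] infdist_cone(2)[OF C(1), of "c - z"]
    by (simp add: l.diff norm_minus_commute)
  moreover have "0 \<le> l c" using l(1) c(1) by (simp add: dual_cone_def)
  moreover have "- l (z - c) \<le> norm (z - c)"
    using l(2)[of "z - c"] infdist_cone(2)[OF C(1), of "z - c"] by simp
  ultimately have "l c = 0" using l(3) c(2) by (simp add: l.diff)
  with c l(1) e
  show "\<exists>c\<in>C. \<exists>l'\<in>dual_cone C. l' c = 0 \<and> norm (z - c) \<le> 1 * infdist z C + e \<and>
      (\<forall>x. \<bar>l' x - l x\<bar> \<le> e * norm x)"
    by (intro bexI[of _ c] bexI[of _ l]) auto
qed (use infdist_cone[OF C(1)] infdist_nonneg in_closed_iff_infdist_zero[OF C(2)]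
  convex_cone_nonempty[OF C(1)] in auto)

text \<open>At an almost nearest point \<open>c\<close> the value \<open>l c\<close> is small;
  \<open>approximate_support_cone\<close> then moves \<open>c\<close> and \<open>l\<close> slightly
  to obtain exact support.\<close>

lemma supported_gauge_infdist_complete:
  fixes C :: "'a::real_normed_vector set"
  assumes C: "convex_cone C" "complete C"
  shows "supported_gauge C (\<lambda>x. infdist x C) 1"
proof
  fix l z and e :: real
  assume l: "l \<in> dual_cone C" "\<And>x. - l x \<le> infdist x C" "l z = - infdist z C" and e: "0 < e"
  interpret l: bounded_linear l using l(1) by (simp add: dual_cone_def)
  define d where "d = e / 2"
  \<comment> \<open>\<open>h \<le> d * d\<close> gives the smallness required of \<open>l c\<close>,
    and \<open>h \<le> d\<close> keeps the total error within \<open>d + d = e\<close>.\<close>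
  define h where "h = min d (d * d)"
  have d: "0 < d" and h: "0 < h" "h \<le> d" "h \<le> d * d"
    using e by (auto simp: d_def h_def)
  have ne: "C \<noteq> {}" by (rule convex_cone_nonempty[OF C(1)])
  have "(INF c\<in>C. dist z c) < infdist z C + h"
    using h by (simp add: infdist_notempty[OF ne])
  then obtain c where c: "c \<in> C" "norm (z - c) < infdist z C + h"
    unfolding cINF_less_iff[OF ne bdd_below_image_dist] by (auto simp: dist_norm)
  have "l c \<le> h"
    using c(2) l(2)[of "z - c"] l(3) infdist_cone(2)[OF C(1), of "z - c"]
    by (simp add: l.diff)
  then have "l c \<le> d * d" using h by simp
  then obtain c' l' where c': "c' \<in> C" "l' \<in> dual_cone C" "l' c' = 0" "norm (c - c') \<le> d"
    and l': "\<And>x. \<bar>l' x - l x\<bar> \<le> d * norm x"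
    using approximate_support_cone[OF C l(1) c(1) d] by metis
  have "norm (z - c') \<le> norm (z - c) + norm (c - c')"
    by (rule norm_diff_triangle_ineq[of z c c c', simplified])
  then have "norm (z - c') \<le> 1 * infdist z C + e"
    using c(2) c'(4) h(2) by (simp add: d_def)
  moreover have "\<bar>l' x - l x\<bar> \<le> e * norm x" for x
    using e by (intro order_trans[OF l'] mult_right_mono) (auto simp: d_def)
  ultimately show "\<exists>c\<in>C. \<exists>l'\<in>dual_cone C. l' c = 0 \<and> norm (z - c) \<le> 1 * infdist z C + e \<and>
      (\<forall>x. \<bar>l' x - l x\<bar> \<le> e * norm x)"
    using c' by blast
qed (use infdist_cone[OF C(1)] infdist_nonneg convex_cone_nonempty[OF C(1)]
  in_closed_iff_infdist_zero[OF complete_imp_closed[OF C(2)]] in auto)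

text \<open>For an interior point \<open>e\<close> of \<open>C\<close> this is the one-sided form of
  the order-unit norm.\<close>

definition order_gauge :: "'a::real_vector set \<Rightarrow> 'a \<Rightarrow> 'a \<Rightarrow> real" where
  "order_gauge C e z = Inf {s. 0 \<le> s \<and> z + s *\<^sub>R e \<in> C}"

text \<open>The point \<open>c\<close> obtained by pushing \<open>z\<close> along \<open>u\<close>
  into \<open>C\<close> replaces the nearest point: the gauge of \<open>- u\<close> is at most
  \<open>1\<close>, so \<open>l u \<le> 1\<close> and \<open>l c \<le> 0\<close>. In the constant,
  \<open>1 / r\<close> bounds the gauge by the norm, and \<open>norm u\<close> bounds
  \<open>norm (z - c)\<close> by the gauge.\<close>

lemma supported_gauge_order_gauge:
  fixes C :: "'a::real_normed_vector set"
  assumes C: "convex_cone C" "closed C" and r: "0 < r" "cball u r \<subseteq> C"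
  shows "supported_gauge C (order_gauge C u) (1 / r + norm u)"
proof -
  let ?p = "order_gauge C u"
  define S where "S z = {s. 0 \<le> s \<and> z + s *\<^sub>R u \<in> C}" for z
  have p_def: "?p z = Inf (S z)" for z by (simp add: order_gauge_def S_def)
  have bdd: "bdd_below (S z)" for z by (intro bdd_belowI[of _ 0]) (auto simp: S_def)
  have p_le: "?p z \<le> s" if "0 \<le> s" "z + s *\<^sub>R u \<in> C" for z s
    unfolding p_def using that by (intro cInf_lower bdd) (auto simp: S_def)
  \<comment> \<open>A multiple of \<open>z\<close> of norm \<open>r\<close> added to
    \<open>u\<close> stays in the ball; the sum is then scaled by \<open>norm z / r\<close>.\<close>
  have in_S: "norm z / r \<in> S z" for z
  proof (cases "z = 0")
    case True
    then show ?thesis using convex_cone_contains_0[OF C(1)] by (simp add: S_def)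
  next
    case False
    have "u + (r / norm z) *\<^sub>R z \<in> C"
      using r False by (intro subsetD[OF r(2)]) (simp add: dist_norm)
    then have "(norm z / r) *\<^sub>R (u + (r / norm z) *\<^sub>R z) \<in> C"
      using r by (intro convex_cone_scaleR[OF C(1)]) auto
    then show ?thesis
      using r False by (simp add: S_def scaleR_add_right add.commute)
  qed
  have "closed (S z)" for z
  proof -
    have "S z = {0..} \<inter> (\<lambda>s. z + s *\<^sub>R u) -` C" by (auto simp: S_def)
    moreover have "closed ((\<lambda>s. z + s *\<^sub>R u) -` C)"
      by (intro closed_vimage C continuous_intros)
    ultimately show ?thesis by auto
  qed
  \<comment> \<open>Closedness makes the infimum attained.\<close>
  then have "?p z \<in> S z" for z
    unfolding p_def using in_S[of z] by (intro closed_contains_Inf bdd) auto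
  then have p_nonneg: "0 \<le> ?p z" and p_in: "z + ?p z *\<^sub>R u \<in> C" for z
    by (auto simp: S_def)
  have p_zero: "?p z = 0 \<longleftrightarrow> z \<in> C" for z
    using p_in[of z] p_le[of 0 z] p_nonneg[of z] by auto
  show ?thesis
  proof
    show "sublinear ?p"
    proof (rule sublinearI)
      fix x y
      have "(x + ?p x *\<^sub>R u) + (y + ?p y *\<^sub>R u) \<in> C"
        by (intro convex_cone_add[OF C(1)] p_in)
      then show "?p (x + y) \<le> ?p x + ?p y"
        using p_nonneg[of x] p_nonneg[of y] by (intro p_le) (auto simp: algebra_simps)
    next
      fix t :: real and x assume "0 < t"
      moreover from this have "t *\<^sub>R (x + ?p x *\<^sub>R u) \<in> C"
        by (intro convex_cone_scaleR[OF C(1)] p_in) auto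
      ultimately show "?p (t *\<^sub>R x) \<le> t * ?p x"
        using p_nonneg[of x] by (intro p_le) (auto simp: scaleR_add_right)
    next
      show "?p 0 = 0" using p_zero convex_cone_contains_0[OF C(1)] by simp
    qed
    fix z
    show "0 \<le> ?p z" by (rule p_nonneg)
    show "?p z = 0 \<longleftrightarrow> z \<in> C" by (rule p_zero)
    show "?p z \<le> (1 / r + norm u) * norm z"
      using in_S[of z] p_le[of "norm z / r" z] by (simp add: S_def distrib_right add_increasing2)
    show "0 < 1 / r + norm u" using r by (simp add: add_pos_nonneg)
    fix l and e :: real
    assume l: "l \<in> dual_cone C" "\<And>x. - l x \<le> ?p x" "l z = - ?p z" and e: "0 < e"
    interpret l: bounded_linear l using l(1) by (simp add: dual_cone_def)
    define c where "c = z + ?p z *\<^sub>R u"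
    have "?p (- u) \<le> 1"
      using convex_cone_contains_0[OF C(1)] by (intro p_le) auto
    then have "l u \<le> 1" using l(2)[of "- u"] by (simp add: l.neg)
    then have "l c \<le> 0"
      using mult_left_mono[of "l u" 1 "?p z"] p_nonneg[of z] l(3)
      by (simp add: c_def l.add l.scaleR)
    moreover have "c \<in> C" unfolding c_def by (rule p_in)
    ultimately have "l c = 0" using l(1) by (force simp: dual_cone_def)
    have "norm (z - c) \<le> (1 / r + norm u) * ?p z + e"
      using p_nonneg[of z] r e by (simp add: c_def distrib_right)
    with \<open>c \<in> C\<close> \<open>l c = 0\<close> l(1) e
    show "\<exists>c\<in>C. \<exists>l'\<in>dual_cone C. l' c = 0 \<and> norm (z - c) \<le> (1 / r + norm u) * ?p z + e \<and>
        (\<forall>x. \<bar>l' x - l x\<bar> \<le> e * norm x)"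
      by (intro bexI[of _ c] bexI[of _ l]) auto
  qed
qed

lemma exists_supported_gauge:
  fixes C :: "'a::real_normed_vector set"
  assumes C: "convex_cone C" "closed C"
    and alt: "interior C \<noteq> {} \<or> complete (UNIV :: 'a set) \<or> distance_set C"
  obtains p M where "supported_gauge C p M"
proof -
  consider u where "u \<in> interior C" | "complete (UNIV :: 'a set)" | "distance_set C"
    using alt by auto
  then show thesis
  proof cases
    case 1
    then obtain r where "0 < r" "cball u r \<subseteq> C" by (auto simp: mem_interior_cball)
    from supported_gauge_order_gauge[OF C this] show thesis by (rule that)
  next
    case 2
    then have "complete C"
      using complete_Int_closed[OF 2 C(2)] by simp
    from supported_gauge_infdist_complete[OF C(1) this] show thesis by (rule that)
  next
    case 3
    from supported_gauge_infdist_distance_set[OF C this] show thesis by (rule that)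
  qed
qed

section \<open>Comparison of solutions with supersolutions\<close>

context supported_gauge
begin

lemma abs_diff_le: "\<bar>p x - p y\<bar> \<le> M * norm (x - y)"
  using sublinear_add[OF sublinear, of y "x - y"] sublinear_add[OF sublinear, of x "y - x"]
    le_norm[of "x - y"] le_norm[of "y - x"]
  by (simp add: abs_le_iff norm_minus_commute)

lemma continuous_on_gauge: "continuous_on A p"
proof (rule lipschitz_on_continuous_on)
  show "M-lipschitz_on A p"
    using M_pos abs_diff_le by (intro lipschitz_onI) (auto simp: dist_norm)
qed

text \<open>\<open>l\<close> is the negative of a linear minorant touching \<open>p\<close> at
  \<open>z\<close>. It is nonnegative on \<open>C\<close> because \<open>p\<close> vanishes there,
  and bounded by \<open>le_norm\<close>.\<close>

lemma exists_functional:
  obtains l where "l \<in> dual_cone C" "\<And>x. - l x \<le> p x" "l z = - p z"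
proof -
  obtain m where m: "linear m" "\<And>x. m x \<le> p x" "m z = p z"
    using exists_linear_minorant_touching[OF sublinear] by blast
  have "\<bar>m x\<bar> \<le> M * norm x" for x
    using m(2)[of x] m(2)[of "- x"] le_norm[of x] le_norm[of "- x"] linear_neg[OF m(1), of x]
    by (simp add: abs_le_iff)
  then have "bounded_linear m"
    using linear_add[OF m(1)] linear_scale[OF m(1)]
    by (intro bounded_linear_intro[of _ M]) (auto simp: mult.commute)
  then have "bounded_linear (\<lambda>x. - m x)"
    by (rule bounded_linear_minus)
  moreover have "m c \<le> 0" if "c \<in> C" for c
    using m(2)[of c] zero_iff[of c] that by simp
  ultimately show thesis
    using m by (intro that[of "\<lambda>x. - m x"]) (auto simp: dual_cone_def)
qed

text \<open>The difference is split at \<open>x + c\<close>, with \<open>c\<close> supplied by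
  \<open>support\<close> for \<open>y - x\<close>. Quasi-monotonicity covers the step from
  \<open>x\<close> to \<open>x + c\<close> up to a small error, the Lipschitz bound the step from
  there to \<open>y\<close>. One factor \<open>M\<close> comes from
  \<open>- l \<le> p \<le> M * norm\<close>, the other from the distance between
  \<open>x + c\<close> and \<open>y\<close>.\<close>

lemma quasi_monotone_functional_bound:
  assumes qm: "quasi_monotone_increasing C U g" and x: "x \<in> U" and y: "y \<in> U"
    and L: "0 \<le> L"
    and lip: "\<And>a. norm (a - y) < d \<Longrightarrow> a \<in> U \<and> norm (g a - g y) \<le> L * norm (a - y)"
    and l: "l \<in> dual_cone C" "\<And>v. - l v \<le> p v" "l (y - x) = - p (y - x)"
    and close: "M * p (y - x) < d"
  shows "- l (g y - g x) \<le> M * M * L * p (y - x)"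
proof -
  define P where "P = p (y - x)"
  define N where "N = norm (g y - g x)"
  interpret l: bounded_linear l using l(1) by (simp add: dual_cone_def)
  have bound: "- l (g y - g x) \<le> M * (L * (M * P + e)) + e * (L * (M * P + e) + N)"
    if e: "0 < e" "M * P + e < d" for e
  proof -
    obtain c l' where c: "c \<in> C" "l' \<in> dual_cone C" "l' c = 0" "norm (y - x - c) \<le> M * P + e"
      and l': "\<And>v. \<bar>l' v - l v\<bar> \<le> e * norm v"
      using support[OF l e(1)] unfolding P_def by blast
    interpret l': bounded_linear l' using c(2) by (simp add: dual_cone_def)
    let ?a = "x + c"
    have near: "norm (?a - y) \<le> M * P + e"
      using c(4) by (metis diff_diff_eq norm_minus_commute)
    then have a: "?a \<in> U" "norm (g ?a - g y) \<le> L * norm (?a - y)"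
      using lip[of ?a] e by auto
    have ga: "norm (g ?a - g y) \<le> L * (M * P + e)"
      using a(2) mult_left_mono[OF near L] by simp
    \<comment> \<open>\<open>l' c = 0\<close> provides the equality \<open>l' x = l' (x + c)\<close>
      that quasi-monotonicity asks for.\<close>
    have "l' (g x) \<le> l' (g ?a)"
      using qm x a(1) c by (auto simp: quasi_monotone_increasing_def cone_le_def l'.add)
    then have "- l (g ?a - g x) \<le> e * norm (g ?a - g x)"
      using l'[of "g ?a - g x"] by (simp add: l'.diff)
    also have "norm (g ?a - g x) \<le> L * (M * P + e) + N"
      using norm_triangle_ineq[of "g ?a - g y" "g y - g x"] ga by (simp add: N_def)
    finally have 1: "- l (g ?a - g x) \<le> e * (L * (M * P + e) + N)"
      using e by simp
    have "- l (g y - g ?a) \<le> M * norm (g y - g ?a)"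
      using l(2) le_norm order_trans by blast
    also have "\<dots> \<le> M * (L * (M * P + e))"
      using ga M_pos by (simp add: norm_minus_commute)
    finally show ?thesis using 1 by (simp add: l.diff)
  qed
  have "((\<lambda>e. M * (L * (M * P + e)) + e * (L * (M * P + e) + N)) \<longlongrightarrow>
      M * (L * (M * P + 0)) + 0 * (L * (M * P + 0) + N)) (at_right 0)"
    by (intro tendsto_intros)
  moreover have "\<forall>\<^sub>F e in at_right 0. - l (g y - g x) \<le> M * (L * (M * P + e)) + e * (L * (M * P + e) + N)"
    unfolding eventually_at_right_field
    using close bound by (intro exI[of _ "d - M * P"]) (auto simp: P_def)
  ultimately have "- l (g y - g x) \<le> M * (L * (M * P + 0)) + 0 * (L * (M * P + 0) + N)"
    by (rule tendsto_lowerbound) simp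
  then show ?thesis by (simp add: P_def algebra_simps)
qed

text \<open>At the first time \<open>t\<close> at which \<open>p (y t - x t)\<close> reaches \<open>e * exp (K * t)\<close>, a functional
  realising \<open>p (y t - x t)\<close> has too large a left derivative along \<open>y - x\<close>.\<close>

lemma comparison:
  assumes dx: "\<And>t. t \<in> {0..b} \<Longrightarrow> (x has_vector_derivative f t (x t)) (at t within {0..b})"
    and dy: "\<And>t. t \<in> {0..b} \<Longrightarrow> (y has_vector_derivative y' t) (at t within {0..b})"
    and super: "\<And>t. t \<in> {0..b} \<Longrightarrow> cone_le C (f t (y t)) (y' t)"
    and xU: "\<And>t. t \<in> {0..b} \<Longrightarrow> x t \<in> U" and yU: "\<And>t. t \<in> {0..b} \<Longrightarrow> y t \<in> U"
    and qm: "\<And>t. t \<in> {0..b} \<Longrightarrow> quasi_monotone_increasing C U (f t)"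
    and d: "0 < d" and L: "0 \<le> L"
    and lip: "\<And>t a. t \<in> {0..b} \<Longrightarrow> norm (a - y t) < d \<Longrightarrow>
      a \<in> U \<and> norm (f t a - f t (y t)) \<le> L * norm (a - y t)"
    and init: "cone_le C (x 0) (y 0)" and b: "0 \<le> b"
  shows "cone_le C (x b) (y b)"
proof -
  define z where "z t = y t - x t" for t
  \<comment> \<open>The extra \<open>1\<close> makes the derivative estimate at the first contact
    strict.\<close>
  define K where "K = M * M * L + 1"
  have K: "0 \<le> K" using L by (simp add: K_def)
  have dz: "(z has_vector_derivative y' t - f t (x t)) (at t within {0..b})" if "t \<in> {0..b}" for t
    unfolding z_def by (intro has_vector_derivative_diff dx dy that)
  have cont_z: "continuous_on {0..b} z"
    using dz has_vector_derivative_continuous by (fastforce simp: continuous_on_eq_continuous_within)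
  \<comment> \<open>The bound on \<open>e\<close> keeps \<open>M * p (z s)\<close> below
    \<open>d\<close> at the contact time \<open>s\<close>, within reach of the Lipschitz
    estimate.\<close>
  have small: "p (z b) \<le> e * exp (K * b)" if e: "0 < e" "M * (e * exp (K * b)) < d" for e
  proof (rule ccontr)
    assume contra: "\<not> p (z b) \<le> e * exp (K * b)"
    define g where "g t = p (z t) - e * exp (K * t)" for t
    have cont_g: "continuous_on {0..b} g"
      unfolding g_def
      by (intro continuous_intros continuous_on_compose2[OF continuous_on_gauge[of UNIV] cont_z]) auto
    have g0: "g 0 < 0"
      using init e zero_iff[of "z 0"] by (simp add: g_def z_def cone_le_def)
    define S where "S = {t \<in> {0..b}. g t = 0}"
    have "\<exists>t\<ge>0. t \<le> b \<and> g t = 0"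
      using g0 contra b cont_g by (intro IVT') (auto simp: g_def)
    then have "S \<noteq> {}" by (auto simp: S_def)
    moreover have "closed S"
      unfolding S_def by (rule continuous_closed_preimage_constant[OF cont_g]) simp
    moreover have bdd: "bdd_below S" by (intro bdd_belowI[of _ 0]) (auto simp: S_def)
    ultimately have "Inf S \<in> S" by (intro closed_contains_Inf)
    then obtain s where s: "s \<in> {0..b}" "g s = 0" "s = Inf S" by (auto simp: S_def)
    have before: "g t < 0" if t: "0 \<le> t" "t < s" for t
    proof (rule ccontr)
      assume "\<not> g t < 0"
      moreover have "continuous_on {0..t} g"
        using t(2) s(1) by (intro continuous_on_subset[OF cont_g]) auto
      ultimately obtain r where r: "0 \<le> r" "r \<le> t" "g r = 0"
        using IVT'[of g 0 0 t] g0 t(1) by auto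
      then have "r \<in> S" using t(2) s(1) by (simp add: S_def)
      then have "s \<le> r" unfolding s(3) by (intro cInf_lower bdd)
      with r(2) t(2) show False by simp
    qed
    have "s \<noteq> 0" using g0 s(2) by (metis less_irrefl)
    with s(1) have s_pos: "0 < s" by simp
    have ps: "p (z s) = e * exp (K * s)" using s(2) by (simp add: g_def)
    obtain l where l: "l \<in> dual_cone C" "\<And>v. - l v \<le> p v" "l (z s) = - p (z s)"
      using exists_functional by blast
    interpret l: bounded_linear l using l(1) by (simp add: dual_cone_def)
    \<comment> \<open>\<open>D\<close> is the derivative at \<open>s\<close> of a function that lies
      below \<open>g\<close> and agrees with it at \<open>s\<close>, where \<open>g s = 0\<close>. A
      negative \<open>D\<close> thus makes \<open>g\<close> positive just before \<open>s\<close>,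
      against \<open>before\<close>.\<close>
    define D where "D = - l (y' s - f s (x s)) - e * (K * exp (K * s))"
    have "((\<lambda>t. l (z t)) has_real_derivative l (y' s - f s (x s))) (at s within {0..b})"
      unfolding has_real_derivative_iff_has_vector_derivative
      by (rule l.has_vector_derivative[OF dz[OF s(1)]])
    then have deriv: "((\<lambda>t. - l (z t) - e * exp (K * t)) has_real_derivative D) (at s within {0..b})"
      unfolding D_def by (auto intro!: derivative_eq_intros)
    have "exp (K * s) \<le> exp (K * b)"
      using s(1) K by (simp add: mult_left_mono)
    then have "M * p (z s) \<le> M * (e * exp (K * b))"
      unfolding ps using e(1) M_pos by (intro mult_left_mono) auto
    then have "M * p (y s - x s) < d"
      using e(2) by (simp add: z_def)
    then have "- l (f s (y s) - f s (x s)) \<le> M * M * L * p (y s - x s)"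
      by (intro quasi_monotone_functional_bound[where d = d,
            OF qm[OF s(1)] xU[OF s(1)] yU[OF s(1)] L lip[OF s(1)] l(1,2) l(3)[unfolded z_def]])
    moreover have "0 \<le> l (y' s - f s (y s))"
      using l(1) super[OF s(1)] by (auto simp: dual_cone_def cone_le_def)
    ultimately have "- l (y' s - f s (x s)) \<le> M * M * L * p (z s)"
      by (simp add: z_def l.diff)
    also have "\<dots> < K * p (z s)"
      using ps e by (simp add: K_def)
    also have "K * p (z s) = e * (K * exp (K * s))"
      by (simp add: ps)
    finally have "D < 0" by (simp add: D_def)
    then obtain h0 where h0: "0 < h0"
      "\<And>h. 0 < h \<Longrightarrow> s - h \<in> {0..b} \<Longrightarrow> h < h0 \<Longrightarrow>
        - l (z s) - e * exp (K * s) < - l (z (s - h)) - e * exp (K * (s - h))"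
      using has_real_derivative_neg_dec_left[OF deriv] by blast
    define h where "h = min s (h0 / 2)"
    have h: "0 < h" "h \<le> s" "h < h0" using s_pos h0(1) by (auto simp: h_def)
    then have "- l (z s) - e * exp (K * s) < - l (z (s - h)) - e * exp (K * (s - h))"
      using s by (intro h0) auto
    also have "\<dots> \<le> g (s - h)" using l(2) by (simp add: g_def)
    also have "\<dots> < 0" using h by (intro before) auto
    finally show False using l(3) ps by simp
  qed
  have "((\<lambda>e. e * exp (K * b)) \<longlongrightarrow> 0 * exp (K * b)) (at_right 0)"
    by (intro tendsto_intros)
  moreover have "\<forall>\<^sub>F e in at_right 0. p (z b) \<le> e * exp (K * b)"
    unfolding eventually_at_right_field
  proof (intro exI conjI allI impI)
    show "0 < d / (M * exp (K * b))" using d M_pos by simp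
    fix e assume "0 < e" "e < d / (M * exp (K * b))"
    then show "p (z b) \<le> e * exp (K * b)"
      using M_pos by (intro small) (auto simp: field_simps)
  qed
  ultimately have "p (z b) \<le> 0 * exp (K * b)"
    by (rule tendsto_lowerbound) simp
  then have "p (z b) = 0" using nonneg[of "z b"] by simp
  then show ?thesis using zero_iff by (simp add: z_def cone_le_def)
qed

end

section \<open>Uniform Lipschitz bounds near compact sets\<close>

lemma compact_convergent_sequence:
  fixes s :: "nat \<Rightarrow> 'a::metric_space"
  assumes "s \<longlonglongrightarrow> l"
  shows "compact (insert l (range s))"
  using compactin_sequence_with_limit[of euclidean s l "range s"] assms by simp

text \<open>Lipschitz continuity on compact sets is automatically uniform on a neighbourhood of a
  compact set: otherwise, the range of a sequence of counterexamples, together with the limit of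
  a subsequence, would be a compact set on which the map is not Lipschitz.\<close>

lemma paper_locally_lipschitz_neighbourhood:
  fixes U :: "'a::real_normed_vector set"
  assumes lip: "paper_locally_lipschitz I U f" and b: "b \<in> I"
    and U: "open U" and Y: "compact Y" "Y \<subseteq> U"
  obtains d L where "0 < d" "0 \<le> L"
    "\<And>t y a. t \<in> {0..b} \<Longrightarrow> y \<in> Y \<Longrightarrow> norm (a - y) < d \<Longrightarrow>
      a \<in> U \<and> norm (f t a - f t y) \<le> L * norm (a - y)"
proof -
  obtain d0 where d0: "0 < d0" "(\<Union>y\<in>Y. ball y d0) \<subseteq> U"
    by (rule compact_subset_open_imp_ball_epsilon_subset[OF Y(1) U Y(2)])
  have d0U: "a \<in> U" if "y \<in> Y" "norm (a - y) < d0" for y a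
    using that d0(2) by (force simp: dist_norm norm_minus_commute)
  \<comment> \<open>One index serves both as Lipschitz constant and as inverse radius, so failure
    for every \<open>n\<close> yields pairs with distances tending to \<open>0\<close> and unbounded
    quotients.\<close>
  have "\<exists>n::nat. \<forall>t y a. t \<in> {0..b} \<and> y \<in> Y \<and> norm (a - y) < min d0 (inverse (Suc n)) \<longrightarrow>
      norm (f t a - f t y) \<le> Suc n * norm (a - y)"
  proof (rule ccontr)
    assume "\<not> ?thesis"
    then have "\<forall>n::nat. \<exists>t y a. t \<in> {0..b} \<and> y \<in> Y \<and> norm (a - y) < min d0 (inverse (Suc n)) \<and>
        Suc n * norm (a - y) < norm (f t a - f t y)"
      by (simp add: not_le)
    then obtain t y a where "\<forall>n::nat. t n \<in> {0..b} \<and> y n \<in> Y \<and>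
        norm (a n - y n) < min d0 (inverse (Suc n)) \<and>
        Suc n * norm (a n - y n) < norm (f (t n) (a n) - f (t n) (y n))"
      unfolding choice_iff by (elim exE)
    then have seq: "\<And>n. t n \<in> {0..b}" "\<And>n. y n \<in> Y"
        "\<And>n. norm (a n - y n) < d0" "\<And>n. norm (a n - y n) < inverse (Suc n)"
        "\<And>n. Suc n * norm (a n - y n) < norm (f (t n) (a n) - f (t n) (y n))"
      by auto
    have "\<forall>n. y n \<in> Y" using seq(2) by simp
    then obtain y0 r where r: "y0 \<in> Y" "strict_mono r" "(y \<circ> r) \<longlonglongrightarrow> y0"
      by (rule seq_compactE[OF compact_imp_seq_compact[OF Y(1)]])
    have "(\<lambda>n. a n - y n) \<longlonglongrightarrow> 0"
    proof (rule Lim_null_comparison)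
      show "\<forall>\<^sub>F n in sequentially. norm (a n - y n) \<le> inverse (Suc n)"
        using less_imp_le[OF seq(4)] by (intro always_eventually allI)
    qed (rule LIMSEQ_inverse_real_of_nat)
    then have "(\<lambda>n. (a (r n) - y (r n)) + (y \<circ> r) n) \<longlonglongrightarrow> 0 + y0"
      using LIMSEQ_subseq_LIMSEQ[OF _ r(2), of "\<lambda>n. a n - y n"] r(3)
      by (intro tendsto_add) (auto simp: o_def)
    then have ar: "(a \<circ> r) \<longlonglongrightarrow> y0" by (simp add: o_def)
    define K where "K = Y \<union> insert y0 (range (a \<circ> r))"
    have "compact K"
      unfolding K_def by (intro compact_Un Y compact_convergent_sequence ar)
    moreover have "K \<subseteq> U"
      using Y(2) r(1) d0U[OF seq(2,3)] by (auto simp: K_def)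
    ultimately have "\<exists>L. \<forall>\<tau>\<in>{0..b}. \<forall>x1\<in>K. \<forall>x2\<in>K. x1 \<noteq> x2 \<longrightarrow>
        norm (f \<tau> x2 - f \<tau> x1) / norm (x2 - x1) \<le> L"
      using lip b by (simp add: paper_locally_lipschitz_def)
    then obtain L where L: "\<forall>\<tau>\<in>{0..b}. \<forall>x1\<in>K. \<forall>x2\<in>K. x1 \<noteq> x2 \<longrightarrow>
        norm (f \<tau> x2 - f \<tau> x1) / norm (x2 - x1) \<le> L"
      by (elim exE)
    \<comment> \<open>As \<open>r\<close> is strictly increasing, \<open>L < n \<le> r n\<close>, so
      the pair with index \<open>r n\<close> violates the bound \<open>L\<close>.\<close>
    obtain n :: nat where n: "L < n" using reals_Archimedean2 by blast
    let ?m = "r n"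
    have ne: "a ?m \<noteq> y ?m" using seq(5)[of ?m] by auto
    have "y ?m \<in> K" "a ?m \<in> K" using seq(2) by (auto simp: K_def)
    then have "norm (f (t ?m) (a ?m) - f (t ?m) (y ?m)) / norm (a ?m - y ?m) \<le> L"
      using L seq(1) ne by metis
    then have "norm (f (t ?m) (a ?m) - f (t ?m) (y ?m)) \<le> L * norm (a ?m - y ?m)"
      using ne by (simp add: divide_le_eq)
    moreover have "L < Suc ?m"
      using n seq_suble[OF r(2), of n] by simp
    then have "L * norm (a ?m - y ?m) \<le> Suc ?m * norm (a ?m - y ?m)"
      by (intro mult_right_mono) auto
    ultimately show False using seq(5)[of ?m] by simp
  qed
  then obtain n :: nat where "\<And>t y a. t \<in> {0..b} \<Longrightarrow> y \<in> Y \<Longrightarrow>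
      norm (a - y) < min d0 (inverse (Suc n)) \<Longrightarrow> norm (f t a - f t y) \<le> Suc n * norm (a - y)"
    by blast
  with d0(1) d0U show thesis
    by (intro that[of "min d0 (inverse (Suc n))" "Suc n"]) auto
qed

section \<open>Convex dependence on the initial value\<close>

text \<open>Membership of \<open>0\<close>, and with it scaling by \<open>0\<close>, comes from the
  equality in the last clause of properness.\<close>

lemma proper_cone_imp_convex_cone: "proper_cone C \<Longrightarrow> convex_cone C"
  unfolding proper_cone_def is_cone_def convex_cone_iff
  by (metis IntD1 insertI1 order_le_less scaleR_zero_left)

theorem mainTheorem7:
  fixes C :: "'a::real_normed_vector set"
    and T t0 :: ereal
    and U :: "'a set"
    and f :: "real \<Rightarrow> 'a \<Rightarrow> 'a"
    and x1 x2 x3 :: "real \<Rightarrow> 'a"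
    and lam :: real
  assumes C_proper: "proper_cone C"
    and C_closed: "closed C"
    and alt: "interior C \<noteq> {} \<or> complete (UNIV :: 'a set) \<or> distance_set C"
    and T_pos: "0 < T"
    and U_open: "open U" and U_convex: "convex U"
    and f_cont: "continuous_on ({t. 0 \<le> t \<and> ereal t < T} \<times> U) (\<lambda>(t, x). f t x)"
    and f_lip: "paper_locally_lipschitz {t. 0 \<le> t \<and> ereal t < T} U f"
    and f_qm: "\<And>t. 0 \<le> t \<Longrightarrow> ereal t < T \<Longrightarrow> quasi_monotone_increasing C U (f t)"
    and f_conv: "\<And>t. 0 \<le> t \<Longrightarrow> ereal t < T \<Longrightarrow> cone_convex_map C U (f t)"
    and t0: "0 < t0" "t0 \<le> T"
    and x1: "\<And>t. 0 \<le> t \<Longrightarrow> ereal t < t0 \<Longrightarrow> x1 t \<in> U \<and>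
               (x1 has_vector_derivative f t (x1 t)) (at t within {s. 0 \<le> s \<and> ereal s < t0})"
    and x2: "\<And>t. 0 \<le> t \<Longrightarrow> ereal t < t0 \<Longrightarrow> x2 t \<in> U \<and>
               (x2 has_vector_derivative f t (x2 t)) (at t within {s. 0 \<le> s \<and> ereal s < t0})"
    and x3: "\<And>t. 0 \<le> t \<Longrightarrow> ereal t < t0 \<Longrightarrow> x3 t \<in> U \<and>
               (x3 has_vector_derivative f t (x3 t)) (at t within {s. 0 \<le> s \<and> ereal s < t0})"
    and lam: "0 \<le> lam" "lam \<le> 1"
    and init: "x3 0 = lam *\<^sub>R x1 0 + (1 - lam) *\<^sub>R x2 0"
  shows "\<forall>t. 0 \<le> t \<and> ereal t < t0 \<longrightarrow>
           cone_le C (x3 t) (lam *\<^sub>R x1 t + (1 - lam) *\<^sub>R x2 t)"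
proof (intro allI impI)
  fix b :: real assume b: "0 \<le> b \<and> ereal b < t0"
  let ?I = "{t. 0 \<le> t \<and> ereal t < T}"
  let ?y = "\<lambda>t. lam *\<^sub>R x1 t + (1 - lam) *\<^sub>R x2 t"
  let ?y' = "\<lambda>t. lam *\<^sub>R f t (x1 t) + (1 - lam) *\<^sub>R f t (x2 t)"
  have dom: "0 \<le> t" "ereal t < t0" "ereal t < T" if "t \<in> {0..b}" for t
  proof -
    show "0 \<le> t" using that by simp
    have "ereal t \<le> ereal b" using that by simp
    then show "ereal t < t0" using b by (meson le_less_trans)
    then show "ereal t < T" using t0 by simp
  qed
  then have sub: "{0..b} \<subseteq> {s. 0 \<le> s \<and> ereal s < t0}" by auto
  have dx: "(x has_vector_derivative f t (x t)) (at t within {0..b})"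
    if "(x has_vector_derivative f t (x t)) (at t within {s. 0 \<le> s \<and> ereal s < t0})" for x t
    using that sub by (rule has_vector_derivative_within_subset)
  have dy: "(?y has_vector_derivative ?y' t) (at t within {0..b})" if "t \<in> {0..b}" for t
    using x1[OF dom(1,2)[OF that]] x2[OF dom(1,2)[OF that]]
    by (auto intro!: derivative_eq_intros dx)
  have yU: "?y t \<in> U" if "t \<in> {0..b}" for t
    using x1[OF dom(1,2)[OF that]] x2[OF dom(1,2)[OF that]] lam
    by (intro convexD[OF U_convex]) auto
  have "continuous_on {0..b} ?y"
    using dy has_vector_derivative_continuous
    by (fastforce simp: continuous_on_eq_continuous_within)
  \<comment> \<open>Compactness of the curve over \<open>{0..b}\<close> lets a single radius
    \<open>d\<close> and constant \<open>L\<close> serve along all of it.\<close>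
  then have "compact (?y ` {0..b})" by (rule compact_continuous_image) simp
  then obtain d L where dL: "0 < d" "0 \<le> L"
    "\<And>t y a. t \<in> {0..b} \<Longrightarrow> y \<in> ?y ` {0..b} \<Longrightarrow> norm (a - y) < d \<Longrightarrow>
      a \<in> U \<and> norm (f t a - f t y) \<le> L * norm (a - y)"
    using paper_locally_lipschitz_neighbourhood[OF f_lip, of b "?y ` {0..b}"] U_open yU b dom(3)[of b]
    by (auto simp: image_subset_iff)
  have C: "convex_cone C" by (rule proper_cone_imp_convex_cone[OF C_proper])
  obtain p M where "supported_gauge C p M"
    using exists_supported_gauge[OF C C_closed alt] by blast
  then interpret supported_gauge C p M .
  show "cone_le C (x3 b) (?y b)"
  proof (rule comparison[where f = f and y' = ?y' and U = U and d = d and L = L])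
    fix t assume t: "t \<in> {0..b}"
    show "(x3 has_vector_derivative f t (x3 t)) (at t within {0..b})" "x3 t \<in> U"
      using x3[OF dom(1,2)[OF t]] by (auto intro: dx)
    show "cone_le C (f t (?y t)) (?y' t)"
      using f_conv[OF dom(1,3)[OF t]] x1[OF dom(1,2)[OF t]] x2[OF dom(1,2)[OF t]] lam
      by (auto simp: cone_convex_map_def)
    show "quasi_monotone_increasing C U (f t)"
      by (rule f_qm[OF dom(1,3)[OF t]])
    show "a \<in> U \<and> norm (f t a - f t (?y t)) \<le> L * norm (a - ?y t)" if "norm (a - ?y t) < d" for a
      using that t by (intro dL(3)) auto
  next
    show "cone_le C (x3 0) (?y 0)"
      using init convex_cone_contains_0[OF C] by (simp add: cone_le_def)
  qed (use dy yU dL b in auto)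
qed

end
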